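(* Let $d\ge 2$ be an integer and let $\mathcal{G}=(V;\varphi)$ be a $d$-graph with chromatic components $G_1,\ldots,G_d$. If $\mathcal{G}$ contains a rainbow triangle, then there exist maximal stable sets $S_i$ of $G_i$, one for each $i\in[d]$, such that $$\bigcap_{i=1}^{d}S_i=\varnothing.$$
   Context: All graphs are finite and simple, and maximality is with respect to inclusion. For a graph $H=(W,F)$, a set $S\subseteq W$ is stable (independent) if no edge of $F$ has both ends in $S$. For an integer $d\ge 2$, write $[d]=\{1,\ldots,d\}$. A $d$-graph is a pair $\mathcal{G}=(V;\varphi)$, where $V$ is a finite vertex set and $\varphi:\binom{V}{2}\to[d]$ is a coloring of the edges of the complete graph on $V$; not every color need be used. For $i\in[d]$, the $i$-th chromatic component is the graph $G_i=(V,E_i)$ with $E_i=\varphi^{-1}(i)$. A triangle (three distinct vertices) is rainbow if its three edges have pairwise distinct colors under $\varphi$. *)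

theory Defs
  imports "HOL-Library.Ramsey"
begin

text \<open>
  A finite simple graph is given by its vertex set and its set of edges, the edges being
  two-element vertex sets. Below, \<open>[V]\<^bsup>2\<^esup>\<close> is the library's set of all two-element subsets
  of \<open>V\<close>.
\<close>

type_synonym 'a graph = "'a set \<times> 'a set set"

definition stable :: "'a graph \<Rightarrow> 'a set \<Rightarrow> bool" where
  "stable H S \<longleftrightarrow> S \<subseteq> fst H \<and> indep S (snd H)"

definition maximal_stable :: "'a graph \<Rightarrow> 'a set \<Rightarrow> bool" where
  "maximal_stable H S \<longleftrightarrow> stable H S \<and> (\<forall>T. stable H T \<and> S \<subseteq> T \<longrightarrow> T = S)"

text \<open>
  The values of the coloring \<open>\<phi>\<close> outside \<open>[V]\<^bsup>2\<^esup>\<close> are irrelevant.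
\<close>

definition d_graph :: "nat \<Rightarrow> 'a set \<Rightarrow> ('a set \<Rightarrow> nat) \<Rightarrow> bool" where
  "d_graph d V \<phi> \<longleftrightarrow> finite V \<and> \<phi> \<in> [V]\<^bsup>2\<^esup> \<rightarrow> {1..d}"

definition chromatic_component :: "'a set \<Rightarrow> ('a set \<Rightarrow> nat) \<Rightarrow> nat \<Rightarrow> 'a graph" where
  "chromatic_component V \<phi> i = (V, {e \<in> [V]\<^bsup>2\<^esup>. \<phi> e = i})"

definition rainbow_triangle :: "'a set \<Rightarrow> ('a set \<Rightarrow> nat) \<Rightarrow> 'a \<Rightarrow> 'a \<Rightarrow> 'a \<Rightarrow> bool" where
  "rainbow_triangle V \<phi> x y z \<longleftrightarrow>
     x \<in> V \<and> y \<in> V \<and> z \<in> V \<and> x \<noteq> y \<and> y \<noteq> z \<and> x \<noteq> z \<and>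
     \<phi> {x, y} \<noteq> \<phi> {y, z} \<and> \<phi> {y, z} \<noteq> \<phi> {x, z} \<and> \<phi> {x, y} \<noteq> \<phi> {x, z}"

end

theory Submission
  imports Defs
begin

text \<open>
  A choice of maximal stable sets has empty intersection as soon as it extends a choice of stable
  sets \<open>A i\<close> such that every vertex \<open>v\<close> has, for some color \<open>i\<close>, a neighbor of color \<open>i\<close> in \<open>A i\<close>:
  no stable superset of \<open>A i\<close> can then contain \<open>v\<close>. Such \<open>A\<close> are called dominating here, and it
  suffices to produce one from a rainbow triangle.

  This goes by induction on \<open>V\<close>. Let \<open>U\<close> be the set obtained from \<open>V\<close> by deleting all neighbors of a
  vertex \<open>x\<close> of one color \<open>c\<close>. A dominating family of \<open>U\<close> becomes one of \<open>V\<close> when \<open>x\<close> is added to its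
  member of color \<open>c\<close>, since \<open>x\<close> dominates exactly the deleted vertices
  (\<open>dominating_if_dominating_nonneighbors\<close>). If \<open>x y z\<close> is a rainbow triangle, \<open>c\<close> is the color of the
  edge \<open>{y, z}\<close>, and \<open>x\<close> has some neighbor of color \<open>c\<close>, then \<open>U\<close> is smaller than \<open>V\<close> and still
  contains the triangle, so the induction hypothesis applies.

  Thus one may assume that no vertex of a rainbow triangle sees the color of the opposite edge. Let
  \<open>x y z\<close> be a rainbow triangle and let \<open>1, 2, 3\<close> be the colors of \<open>{y, z}\<close>, \<open>{x, z}\<close>, \<open>{x, y}\<close>. The
  family \<open>{x, y}, {y, z}, {x, z}\<close> for the colors \<open>1, 2, 3\<close> and \<open>{x, y, z}\<close> for all others dominates
  every vertex, except for the vertices \<open>p\<close> joined to \<open>x, y, z\<close> by the colors \<open>2, 3, 1\<close>. The other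
  orientation of the triangle fails only at the vertices \<open>q\<close> joined to \<open>x, y, z\<close> by \<open>3, 1, 2\<close>. If both
  \<open>p\<close> and \<open>q\<close> exist, then \<open>{p, q}\<close> forms a rainbow triangle with one of \<open>x, y, z\<close>, because its color
  can equal at most one of those of \<open>{x, y}\<close>, \<open>{y, z}\<close>, \<open>{x, z}\<close>. In that triangle, \<open>p\<close> or \<open>q\<close> does
  see the color of the opposite edge, through another vertex of \<open>x y z\<close>. This contradicts the
  assumption.
\<close>

lemma stable_chromatic_component_iff:
  "stable (chromatic_component V \<phi> i) S \<longleftrightarrow>
     S \<subseteq> V \<and> (\<forall>u\<in>S. \<forall>v\<in>S. u \<noteq> v \<longrightarrow> \<phi> {u, v} \<noteq> i)"
proof -
  have "{u, v} \<in> [V]\<^bsup>2\<^esup> \<longleftrightarrow> u \<in> V \<and> v \<in> V \<and> u \<noteq> v" for u v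
    by (auto simp: nsets_def card_2_iff')
  then show ?thesis
    by (auto simp: stable_def chromatic_component_def indep_def)
qed

lemma stable_extends_to_maximal_stable:
  assumes "finite (fst H)" and "stable H A"
  shows "\<exists>S. maximal_stable H S \<and> A \<subseteq> S"
proof -
  have "{S. stable H S} \<subseteq> Pow (fst H)"
    by (auto simp: stable_def)
  then have "finite {S. stable H S}"
    using assms(1) by (meson finite_Pow_iff finite_subset)
  then obtain S where "S \<in> {S. stable H S}" "A \<subseteq> S" "\<forall>T\<in>{S. stable H S}. S \<subseteq> T \<longrightarrow> T = S"
    using finite_has_maximal2[of "{S. stable H S}" A] assms(2) by auto
  then show ?thesis
    by (auto simp: maximal_stable_def)
qed

definition dominating :: "'a set \<Rightarrow> ('a set \<Rightarrow> nat) \<Rightarrow> (nat \<Rightarrow> 'a set) \<Rightarrow> bool" where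
  "dominating V \<phi> A \<longleftrightarrow>
     (\<forall>i. stable (chromatic_component V \<phi> i) (A i)) \<and>
     (\<forall>v\<in>V. \<exists>u \<in> V - {v}. u \<in> A (\<phi> {u, v}))"

lemma dominating_if_dominating_nonneighbors:
  assumes "x \<in> V" and "dominating {v \<in> V. v = x \<or> \<phi> {x, v} \<noteq> c} \<phi> A"
  shows "dominating V \<phi> (A(c := insert x (A c)))"
  using assms unfolding dominating_def stable_chromatic_component_iff
  by (auto simp: insert_commute)

text \<open>
  Let \<open>A i\<close> consist of \<open>x\<close>, \<open>y\<close> and \<open>z\<close>, except that for the color of each edge of the triangle one
  end of this edge is left out, each vertex for one edge: \<open>x\<close> for \<open>{x, z}\<close>, \<open>y\<close> for \<open>{x, y}\<close>, \<open>z\<close> for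
  \<open>{y, z}\<close>. This makes every \<open>A i\<close> stable. A vertex is undominated only if each of \<open>x\<close>, \<open>y\<close>, \<open>z\<close> is
  joined to it by the one color for which it was left out. Exchanging \<open>y\<close> and \<open>z\<close> gives the other
  orientation of the triangle.
\<close>

lemma rainbow_triangle_dominating_or_undominated:
  assumes "rainbow_triangle V \<phi> x y z"
  shows "(\<exists>A. dominating V \<phi> A) \<or>
    (\<exists>p \<in> V - {x, y, z}. \<phi> {x, p} = \<phi> {x, z} \<and> \<phi> {y, p} = \<phi> {x, y} \<and> \<phi> {z, p} = \<phi> {y, z})"
proof -
  note T = assms[unfolded rainbow_triangle_def]
  define A where "A i = {u \<in> {x, y, z}. (u = x \<longrightarrow> i \<noteq> \<phi> {x, z}) \<and> (u = y \<longrightarrow> i \<noteq> \<phi> {x, y}) \<and>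
    (u = z \<longrightarrow> i \<noteq> \<phi> {y, z})}" for i
  have st: "stable (chromatic_component V \<phi> i) (A i)" for i
    using T unfolding stable_chromatic_component_iff A_def by (auto simp: insert_commute)
  show ?thesis
  proof (cases "dominating V \<phi> A")
    case False
    then obtain p where p: "p \<in> V" "\<And>u. u \<in> V \<Longrightarrow> u \<noteq> p \<Longrightarrow> u \<notin> A (\<phi> {u, p})"
      using st unfolding dominating_def by blast
    have "p \<noteq> x" "p \<noteq> y" "p \<noteq> z"
      using p(2)[of x] p(2)[of y] p(2)[of z] T by (auto simp: A_def insert_commute)
    then show ?thesis
      using p(1) p(2)[of x] p(2)[of y] p(2)[of z] T by (auto simp: A_def)
  qed blast
qed

lemma dominating_if_rainbow_triangle:
  assumes "finite V" and "rainbow_triangle V \<phi> x y z"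
  shows "\<exists>A. dominating V \<phi> A"
  using assms
proof (induction V arbitrary: x y z rule: finite_psubset_induct)
  case (psubset V)
  \<comment> \<open>If \<open>a\<close> sees the color of the opposite edge \<open>{b, c}\<close> through \<open>w\<close>, then deleting all its neighbors of
    that color deletes \<open>w\<close> but spares \<open>b\<close> and \<open>c\<close>.\<close>
  have descent: "\<exists>A. dominating V \<phi> A"
    if "rainbow_triangle V \<phi> a b c" "w \<in> V" "w \<noteq> a" "\<phi> {a, w} = \<phi> {b, c}" for a b c w
  proof -
    let ?U = "{v \<in> V. v = a \<or> \<phi> {a, v} \<noteq> \<phi> {b, c}}"
    have "?U \<subset> V"
      using that by blast
    moreover have "rainbow_triangle ?U \<phi> a b c"
      using that(1) by (auto simp: rainbow_triangle_def)
    ultimately have "\<exists>A. dominating ?U \<phi> A"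
      by (rule psubset.IH)
    then obtain A where A: "dominating ?U \<phi> A" ..
    have "a \<in> V"
      using that(1) by (simp add: rainbow_triangle_def)
    from dominating_if_dominating_nonneighbors[OF this A] show ?thesis
      by blast
  qed
  note T = psubset.prems[unfolded rainbow_triangle_def]
  have "rainbow_triangle V \<phi> x z y"
    using T by (auto simp: rainbow_triangle_def insert_commute)
  note undominated = rainbow_triangle_dominating_or_undominated[OF psubset.prems]
    rainbow_triangle_dominating_or_undominated[OF this]
  show ?case
  proof (rule ccontr)
    assume none: "\<not> ?case"
    obtain p where p: "p \<in> V - {x, y, z}"
      "\<phi> {x, p} = \<phi> {x, z}" "\<phi> {y, p} = \<phi> {x, y}" "\<phi> {z, p} = \<phi> {y, z}"
      using undominated(1) none by blast
    obtain q where q: "q \<in> V - {x, y, z}"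
      "\<phi> {x, q} = \<phi> {x, y}" "\<phi> {y, q} = \<phi> {y, z}" "\<phi> {z, q} = \<phi> {x, z}"
      using undominated(2) none by (auto simp: insert_commute)
    have "p \<noteq> q"
      using p q T by auto
    \<comment> \<open>The edges from \<open>p\<close> and \<open>q\<close> to \<open>x\<close> use the colors of \<open>{x, z}\<close> and \<open>{x, y}\<close>, so \<open>p x q\<close> is rainbow
      unless \<open>{p, q}\<close> has one of these; then \<open>y\<close> or \<open>z\<close> can take the place of \<open>x\<close>.\<close>
    consider "\<phi> {p, q} \<noteq> \<phi> {x, z}" "\<phi> {p, q} \<noteq> \<phi> {x, y}" | "\<phi> {p, q} = \<phi> {x, z}"
      | "\<phi> {p, q} = \<phi> {x, y}"
      by blast
    then show False
    proof cases
      case 1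
      then have "rainbow_triangle V \<phi> p x q"
        using p q T \<open>p \<noteq> q\<close> by (auto simp: rainbow_triangle_def insert_commute)
      \<comment> \<open>Here \<open>{p, y}\<close> has the color of \<open>{x, q}\<close>, both being that of \<open>{x, y}\<close>; the other cases are
        alike.\<close>
      from descent[OF this, of y] show False
        using none p q T by (auto simp: insert_commute)
    next
      case 2
      then have "rainbow_triangle V \<phi> q y p"
        using p q T \<open>p \<noteq> q\<close> by (auto simp: rainbow_triangle_def insert_commute)
      from descent[OF this, of x] show False
        using none p q T by (auto simp: insert_commute)
    next
      case 3
      then have "rainbow_triangle V \<phi> p z q"
        using p q T \<open>p \<noteq> q\<close> by (auto simp: rainbow_triangle_def insert_commute)
      from descent[OF this, of x] show False
        using none p q T by (auto simp: insert_commute)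
    qed
  qed
qed

theorem theorem1p2:
  fixes d :: nat and V :: "'a set" and \<phi> :: "'a set \<Rightarrow> nat"
  assumes "d \<ge> 2"
    and "d_graph d V \<phi>"
    and "\<exists>x y z. rainbow_triangle V \<phi> x y z"
  shows "\<exists>S :: nat \<Rightarrow> 'a set.
           (\<forall>i \<in> {1..d}. maximal_stable (chromatic_component V \<phi> i) (S i)) \<and>
           (\<Inter>i \<in> {1..d}. S i) = {}"
proof -
  have "finite V" and col: "\<And>u v. u \<in> V \<Longrightarrow> v \<in> V \<Longrightarrow> u \<noteq> v \<Longrightarrow> \<phi> {u, v} \<in> {1..d}"
    using assms(2) by (auto simp: d_graph_def nsets_def Pi_iff)
  obtain A where A: "dominating V \<phi> A"
    using dominating_if_rainbow_triangle[OF \<open>finite V\<close>] assms(3) by blast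
  have "\<exists>S. maximal_stable (chromatic_component V \<phi> i) S \<and> A i \<subseteq> S" for i
    using A \<open>finite V\<close>
    by (intro stable_extends_to_maximal_stable) (auto simp: dominating_def chromatic_component_def)
  then obtain S where S: "\<And>i. maximal_stable (chromatic_component V \<phi> i) (S i)"
    and AS: "\<And>i. A i \<subseteq> S i"
    by metis
  have st: "S i \<subseteq> V" "\<And>u v. u \<in> S i \<Longrightarrow> v \<in> S i \<Longrightarrow> u \<noteq> v \<Longrightarrow> \<phi> {u, v} \<noteq> i" for i
    using S[of i] by (auto simp: maximal_stable_def stable_chromatic_component_iff)
  have False if v: "\<And>i. i \<in> {1..d} \<Longrightarrow> v \<in> S i" for v
  proof -
    have "v \<in> V"
      using v[of 1] st(1)[of 1] assms(1) by auto
    then obtain u where u: "u \<in> V - {v}" "u \<in> A (\<phi> {u, v})"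
      using A by (auto simp: dominating_def)
    then have "\<phi> {u, v} \<in> {1..d}"
      using col \<open>v \<in> V\<close> by blast
    then show False
      using st(2)[of u "\<phi> {u, v}" v] v u AS by blast
  qed
  then show ?thesis
    using S by blast
qed

end
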